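(* Let $m\ge 2$ be even and $n\ge 1$. Run Algorithm EVEN (described in the context) with $n$ disks and $m+1$ pegs, and record the digit tuple $(a_n,\dots,a_1)$ after initialization and after every single-step move of any disk. Then the sequence of recorded tuples is exactly the $m$-ary reflected Gray code $G_n$ of length $n$.
   Context: Disks $D_1,\dots,D_n$ have increasing sizes; pegs $P_0,\dots,P_m$ are arranged in a cyclic clockwise order; a clockwise step moves a disk from $P_i$ to $P_{(i+1)\bmod (m+1)}$ and a counterclockwise step from $P_i$ to $P_{(i-1)\bmod(m+1)}$, putting it on top of the target stack. Disks $D_i$ with odd $i$ always move clockwise, disks with even $i$ always counterclockwise. Algorithm EVEN: Initially all disks are on $P_0$ and all digits $a_i=0$. Repeat: (i) move $D_1$ for $m-1$ single clockwise steps; (ii) among the topmost disks of the $m$ pegs that do not carry $D_1$, let $D_k$ be the smallest; if there is none, terminate; (iii) move $D_k$ one step in the direction determined by the parity of $k$. Every time disk $D_i$ is moved, the digit $a_i$ advances to the next value of the periodic sequence $0,1,2,\dots,m-2,m-1,m-2,\dots,2,1,0,1,2,\dots$. The $m$-ary reflected Gray code $G_n$ is a sequence of $n$-tuples $(a_n,\dots,a_1)$, $0\le a_i<m$, defined recursively: $G_0$ consists of the empty tuple; if $G_n=C_1,\dots,C_{m^n}$, then $G_{n+1}$ lists, for $i=1,\dots,m^n$ in order, the tuples $C_ix$ with $x$ running $0,1,\dots,m-1$ if $i$ is odd and $x$ running $m-1,\dots,1,0$ if $i$ is even; here $C_ix$ is the tuple whose digits $(a_{n+1},\dots,a_2)$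 are those of $C_i$ and whose last digit $a_1$ is $x$. *)

theory Defs
  imports Main
begin

text \<open>
  Disks are the numbers \<open>1, \<dots>, n\<close> (a larger number is a larger disk) and pegs the numbers
  \<open>0, \<dots>, m\<close>. The stack on a peg is listed from top to bottom. Instead of the digits
  themselves a configuration stores how often each disk has been moved, since the digit \<open>a\<^sub>i\<close>
  depends on the position in the periodic sequence and not only on its current value.
\<close>

record config =
  stack :: "nat \<Rightarrow> nat list"
  moved :: "nat \<Rightarrow> nat"

definition initial :: "nat \<Rightarrow> config" where
  "initial n = \<lparr>stack = (\<lambda>p. if p = 0 then [1..<n + 1] else []), moved = (\<lambda>d. 0)\<rparr>"

text \<open>One period \<open>0, 1, \<dots>, m - 2, m - 1, m - 2, \<dots>, 1\<close> of the digit sequence.\<close>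

definition digit_period :: "nat \<Rightarrow> nat list" where
  "digit_period m = [0..<m] @ rev [1..<m - 1]"

definition digit :: "nat \<Rightarrow> nat \<Rightarrow> nat" where
  "digit m t = digit_period m ! (t mod length (digit_period m))"

definition digits :: "nat \<Rightarrow> nat \<Rightarrow> config \<Rightarrow> nat list" where
  "digits m n c = map (\<lambda>i. digit m (moved c i)) (rev [1..<n + 1])"

text \<open>Modulo \<open>m + 1\<close>, adding \<open>m\<close> is the counterclockwise step \<open>p - 1\<close>.\<close>

definition next_peg :: "nat \<Rightarrow> nat \<Rightarrow> nat \<Rightarrow> nat" where
  "next_peg m d p = (if odd d then (p + 1) mod (m + 1) else (p + m) mod (m + 1))"

text \<open>
  A disk can be moved only when it is on top of its stack; there is no condition on the target
  stack.
\<close>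

inductive move :: "nat \<Rightarrow> nat \<Rightarrow> config \<Rightarrow> config \<Rightarrow> bool" for m d where
  move: "\<lbrakk>p \<le> m; stack c p = d # ds; s = (stack c)(p := ds); q = next_peg m d p\<rbrakk> \<Longrightarrow>
    move m d c \<lparr>stack = s(q := d # s q), moved = (moved c)(d := moved c d + 1)\<rparr>"

text \<open>
  \<open>move_D1 m n k c tr c'\<close>: moving disk 1 for \<open>k\<close> single steps leads from \<open>c\<close> to \<open>c'\<close>, and
  \<open>tr\<close> lists the digit tuples recorded after these steps.
\<close>

inductive move_D1 :: "nat \<Rightarrow> nat \<Rightarrow> nat \<Rightarrow> config \<Rightarrow> nat list list \<Rightarrow> config \<Rightarrow> bool" for m n where
  zero: "move_D1 m n 0 c [] c"
| step: "\<lbrakk>move m 1 c c'; move_D1 m n k c' tr c''\<rbrakk> \<Longrightarrow>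
    move_D1 m n (Suc k) c (digits m n c' # tr) c''"

definition other_tops :: "nat \<Rightarrow> config \<Rightarrow> nat set" where
  "other_tops m c = {hd (stack c p) | p. p \<le> m \<and> 1 \<notin> set (stack c p) \<and> stack c p \<noteq> []}"

text \<open>
  \<open>EVEN_loop m n c tr\<close>: the loop started in \<open>c\<close> terminates, and \<open>tr\<close> lists the digit tuples
  recorded after its single-step moves.
\<close>

inductive EVEN_loop :: "nat \<Rightarrow> nat \<Rightarrow> config \<Rightarrow> nat list list \<Rightarrow> bool" for m n where
  stop: "\<lbrakk>move_D1 m n (m - 1) c tr c'; other_tops m c' = {}\<rbrakk> \<Longrightarrow> EVEN_loop m n c tr"
| continue: "\<lbrakk>move_D1 m n (m - 1) c tr c'; other_tops m c' \<noteq> {};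
      move m (Min (other_tops m c')) c' c''; EVEN_loop m n c'' tr'\<rbrakk> \<Longrightarrow>
    EVEN_loop m n c (tr @ digits m n c'' # tr')"

definition EVEN_run :: "nat \<Rightarrow> nat \<Rightarrow> nat list list \<Rightarrow> bool" where
  "EVEN_run m n tr \<longleftrightarrow>
    (\<exists>tr'. EVEN_loop m n (initial n) tr' \<and> tr = digits m n (initial n) # tr')"

text \<open>Tuples \<open>(a\<^sub>n, \<dots>, a\<^sub>1)\<close> are lists in this order, so \<open>C\<^sub>i x\<close> appends \<open>x\<close> at the end.\<close>

fun gray :: "nat \<Rightarrow> nat \<Rightarrow> nat list list" where
  "gray m 0 = [[]]"
| "gray m (Suc n) =
    concat (map (\<lambda>i. map (\<lambda>x. gray m n ! (i - 1) @ [x]) (if odd i then [0..<m] else rev [0..<m]))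
      [1..<length (gray m n) + 1])"

end

theory Submission imports Defs "HOL-Number_Theory.Cong" begin

text \<open>
  After \<open>j\<close> moves disk \<open>d\<close> has been moved \<open>j div m^(d-1) - j div m^d\<close> times, as the \<open>j\<close>-th move
  is made by the disk \<open>k\<close> for which \<open>m^(k-1)\<close> is the largest power of \<open>m\<close> that divides \<open>j\<close>. The
  digits of the Gray code change in the same pattern. Since \<open>m\<close> is \<open>-1\<close> modulo \<open>m + 1\<close>, disk \<open>d\<close>
  is on peg \<open>m^(d-1) * t\<close> modulo \<open>m + 1\<close> after \<open>t\<close> moves, whatever its direction. Hence just before
  the \<open>j\<close>-th move all disks below \<open>k\<close> are on the peg \<open>(m - 1) * (j div m)\<close> (modulo \<open>m + 1\<close>), whereas
  disk \<open>k\<close> is on another peg and moves to another peg, so all stacks stay sorted.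
\<close>

definition peg :: "nat \<Rightarrow> nat \<Rightarrow> nat \<Rightarrow> nat" where
  "peg m d t = m ^ (d - 1) * t mod (m + 1)"

text \<open>Only the move counts \<open>f\<close> are free: they fix every peg, and filtering an
  increasing list keeps each stack sorted.\<close>

definition sorted_config :: "nat \<Rightarrow> nat \<Rightarrow> (nat \<Rightarrow> nat) \<Rightarrow> config" where
  "sorted_config m n f =
    \<lparr>stack = (\<lambda>p. filter (\<lambda>d. peg m d (f d) = p) [1..<n + 1]), moved = f\<rparr>"

definition num_moves :: "nat \<Rightarrow> nat \<Rightarrow> nat \<Rightarrow> nat" where
  "num_moves m d j = j div m ^ (d - 1) - j div m ^ d"

definition state :: "nat \<Rightarrow> nat \<Rightarrow> nat \<Rightarrow> config" where
  "state m n j = sorted_config m n (\<lambda>d. num_moves m d j)"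

definition code :: "nat \<Rightarrow> nat \<Rightarrow> nat \<Rightarrow> nat list" where
  "code m n j = map (\<lambda>d. digit m (num_moves m d j)) (rev [1..<n + 1])"

subsection \<open>Single moves\<close>

text \<open>As m is -1 modulo m + 1, its powers alternate between 1 and -1; over the naturals -1
  appears as \<open>m\<close>.\<close>

lemma power_cong_mod_Suc_base:
  fixes m :: nat
  shows "[m ^ e = (if even e then 1 else m)] (mod (m + 1))"
proof (induction e)
  case (Suc e)
  have "m * m + (m + 1) = 1 + m * (m + 1)"
    by simp
  then have "(m * m + (m + 1)) mod (m + 1) = (1 + m * (m + 1)) mod (m + 1)"
    by (rule arg_cong)
  then have sq: "[m * m = 1] (mod (m + 1))"
    by (simp only: cong_def mod_add_self2 mod_mult_self1)
  have "[m * m ^ e = m * (if even e then 1 else m)] (mod (m + 1))"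
    by (rule cong_scalar_left[OF Suc.IH])
  then show ?case
    using sq by (auto intro: cong_trans)
qed simp

text \<open>Both directions add m^(d-1) modulo m + 1: for odd d the exponent is even and the power
  is 1, for even d it is m, the counterclockwise step.\<close>

lemma next_peg_peg:
  assumes "d \<ge> 1"
  shows "next_peg m d (peg m d t) = peg m d (Suc t)"
proof -
  have "[m ^ (d - 1) + m ^ (d - 1) * t = (if odd d then 1 else m) + m ^ (d - 1) * t] (mod (m + 1))"
    using power_cong_mod_Suc_base[of m "d - 1"] assms by (intro cong_add) auto
  then show ?thesis
    by (auto simp: peg_def next_peg_def cong_def mod_simps add.commute)
qed

lemma filter_upt_split:
  assumes "1 \<le> k" "k \<le> n"
  shows "filter P [1..<n + 1] =
    filter P [1..<k] @ (if P k then [k] else []) @ filter P [k + 1..<n + 1]"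
proof -
  have "[1..<n + 1] = [1..<k] @ [k..<n + 1]"
    using assms upt_add_eq_append[of 1 k "n + 1 - k"] by simp
  also have "[k..<n + 1] = k # [k + 1..<n + 1]"
    using assms by (simp add: upt_conv_Cons)
  finally show ?thesis
    by simp
qed

text \<open>Since no smaller disk is on the source or the target peg, disk k is on top of its stack
  and its new stack is sorted again. The equivalence also makes the result of the move
  unique.\<close>

lemma move_sorted_config_iff:
  assumes k: "1 \<le> k" "k \<le> n"
    and free: "\<And>i. 1 \<le> i \<Longrightarrow> i < k \<Longrightarrow>
      peg m i (f i) \<noteq> peg m k (f k) \<and> peg m i (f i) \<noteq> peg m k (Suc (f k))"
  shows "move m k (sorted_config m n f) c \<longleftrightarrow> c = sorted_config m n (f(k := Suc (f k)))"
proof -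
  define p where "p = peg m k (f k)"
  define q where "q = peg m k (Suc (f k))"
  define ds where "ds = filter (\<lambda>d. peg m d (f d) = p) [k + 1..<n + 1]"
  let ?s = "(stack (sorted_config m n f))(p := ds)"
  have p: "p \<le> m"
    unfolding p_def peg_def by (metis Suc_eq_plus1 less_Suc_eq_le mod_less_divisor zero_less_Suc)
  have q: "q = next_peg m k p"
    using k by (simp add: p_def q_def next_peg_peg)
  have empty: "filter (\<lambda>d. peg m d (f d) = r) [1..<k] = []" if "r = p \<or> r = q" for r
    using free that by (auto simp: filter_empty_conv p_def q_def)
  have top: "stack (sorted_config m n f) p = k # ds"
    using empty[of p] unfolding sorted_config_def config.simps filter_upt_split[OF k] ds_def
    by (simp add: p_def)
  have upd: "filter (\<lambda>d. peg m d ((f(k := Suc (f k))) d) = r) [1..<n + 1] =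
      filter (\<lambda>d. peg m d (f d) = r) [1..<k] @ (if q = r then [k] else [])
        @ filter (\<lambda>d. peg m d (f d) = r) [k + 1..<n + 1]" for r
    unfolding filter_upt_split[OF k]
    by (intro arg_cong2[where f = append] filter_cong) (auto simp: q_def)
  have old: "filter (\<lambda>d. peg m d (f d) = r) [1..<n + 1] =
      filter (\<lambda>d. peg m d (f d) = r) [1..<k] @ (if p = r then [k] else [])
        @ filter (\<lambda>d. peg m d (f d) = r) [k + 1..<n + 1]" for r
    unfolding filter_upt_split[OF k] by (simp add: p_def)
  have s: "?s r = (if r = p then ds else filter (\<lambda>d. peg m d (f d) = r) [1..<n + 1])" for r
    by (simp add: sorted_config_def)
  have stack: "?s(q := k # ?s q) =
      (\<lambda>r. filter (\<lambda>d. peg m d ((f(k := Suc (f k))) d) = r) [1..<n + 1])"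
  proof
    fix r
    show "(?s(q := k # ?s q)) r =
        filter (\<lambda>d. peg m d ((f(k := Suc (f k))) d) = r) [1..<n + 1]"
      unfolding upd fun_upd_apply[of ?s] s old using empty[of r] by (auto simp: ds_def)
  qed
  have res: "\<lparr>stack = ?s(q := k # ?s q),
      moved = (moved (sorted_config m n f))(k := moved (sorted_config m n f) k + 1)\<rparr> =
      sorted_config m n (f(k := Suc (f k)))"
    unfolding stack by (simp add: sorted_config_def)
  show ?thesis
  proof
    assume "move m k (sorted_config m n f) c"
    then show "c = sorted_config m n (f(k := Suc (f k)))"
    proof cases
      case (move p' ds' s' q')
      have "k \<in> set (stack (sorted_config m n f) p')"
        using move by simp
      \<comment> \<open>A disk occurs in one stack only, so the peg in the rule is forced.\<close>
      then have "p' = p"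
        by (auto simp: sorted_config_def p_def)
      with move top q res show ?thesis
        by simp
    qed
  next
    assume "c = sorted_config m n (f(k := Suc (f k)))"
    then show "move m k (sorted_config m n f) c"
      using move.intros[OF p top refl q] unfolding res by simp
  qed
qed

subsection \<open>The configuration after a given number of moves\<close>

text \<open>The quotient \<open>j div m ^ e\<close> grows by 1 exactly when m^e divides j + 1, that
  is, for e < k. In the difference of the quotients for d - 1 and d this cancels unless d =
  k.\<close>

lemma num_moves_Suc:
  assumes "m \<ge> 1" "k \<ge> 1" "m ^ (k - 1) dvd Suc j" "\<not> m ^ k dvd Suc j"
  shows "(\<lambda>d. num_moves m d (Suc j)) = (\<lambda>d. num_moves m d j)(k := Suc (num_moves m k j))"
proof
  fix d
  have dvd: "m ^ e dvd Suc j \<longleftrightarrow> e < k" for e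
  proof
    show "e < k" if "m ^ e dvd Suc j"
      using that assms(4) by (metis dvd_trans le_imp_power_dvd not_le)
    show "m ^ e dvd Suc j" if "e < k"
      using that assms(3) by (metis dvd_trans le_imp_power_dvd Suc_diff_1 less_Suc_eq_le
        assms(2) less_eq_Suc_le One_nat_def)
  qed
  have div: "Suc j div m ^ e = j div m ^ e + (if e < k then 1 else 0)" for e
    by (simp add: div_Suc flip: dvd dvd_eq_mod_eq_0)
  have "j div m ^ k \<le> j div m ^ (k - 1)"
    by (intro div_le_mono2) (use assms(1) in \<open>auto intro!: power_increasing\<close>)
  then show "num_moves m d (Suc j) = ((\<lambda>d. num_moves m d j)(k := Suc (num_moves m k j))) d"
    using assms(2) by (auto simp: num_moves_def div)
qed

text \<open>Writing j + 1 = m^i r, disk i has moved m r - r times, which gives the peg m^(i-1) (m-1)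
  r. This equals the stated value, which does not depend on i, so all disks smaller than the mover
  share the peg of disk 1.\<close>

lemma peg_lower:
  assumes "m \<ge> 1" "i \<ge> 1" "m ^ i dvd Suc j"
  shows "peg m i (num_moves m i j) = (m - 1) * (Suc j div m) mod (m + 1)"
proof -
  obtain r where r: "Suc j = m ^ i * r"
    using assms(3) by blast
  then have "r > 0"
    by (cases r) auto
  have pow: "m ^ i = m * m ^ (i - 1)"
    using assms(2) by (cases i) auto
  have dvd: "m ^ (i - 1) dvd Suc j"
    using r pow by simp
  have "Suc j div m ^ i = Suc (j div m ^ i)" "Suc j div m ^ (i - 1) = Suc (j div m ^ (i - 1))"
    using assms(3) dvd by (simp_all add: div_Suc dvd_eq_mod_eq_0)
  moreover have "Suc j div m ^ i = r" "Suc j div m ^ (i - 1) = m * r"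
    using r pow assms(1) by simp_all
  ultimately have "num_moves m i j = m * r - r"
    by (simp add: num_moves_def)
  moreover have "Suc j div m = m ^ (i - 1) * r"
    using r pow assms(1) by simp
  ultimately show ?thesis
    by (simp add: peg_def algebra_simps)
qed

text \<open>Let (j + 1) / m^(k-1) = m r + s with 0 < s < m. Once the unit m^(k-2) is cancelled, the
  peg of disk k differs from the common peg of the smaller disks by s + 1 before the move and by s
  after it, modulo m + 1; both lie between 1 and m.\<close>

lemma peg_mover:
  assumes "m \<ge> 1" "k \<ge> 2" "m ^ (k - 1) dvd Suc j" "\<not> m ^ k dvd Suc j"
  shows "peg m k (num_moves m k j) \<noteq> (m - 1) * (Suc j div m) mod (m + 1)"
    and "peg m k (Suc (num_moves m k j)) \<noteq> (m - 1) * (Suc j div m) mod (m + 1)"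
proof -
  define e where "e = k - 2"
  obtain q where q: "Suc j = m ^ (k - 1) * q"
    using assms(3) by blast
  define r s where "r = q div m" and "s = q mod m"
  have qrs: "q = m * r + s"
    by (simp add: r_def s_def)
  have pow: "m ^ k = m ^ (k - 1) * m" "m ^ (k - 1) = m * m ^ e"
    using assms(2) by (simp_all add: e_def flip: power_Suc power_Suc2) (simp_all add: numeral_2_eq_2 Suc_diff_Suc)
  have "s \<noteq> 0"
    using assms(4) q pow by (auto simp: s_def dvd_eq_mod_eq_0[symmetric])
  moreover have "s < m"
    using assms(1) by (simp add: s_def)
  ultimately have s: "0 < s" "s < m"
    by auto
  have "Suc j div m ^ (k - 1) = Suc (j div m ^ (k - 1))" "Suc j div m ^ k = j div m ^ k"
    using assms(3,4) by (simp_all add: div_Suc dvd_eq_mod_eq_0)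
  moreover have "Suc j div m ^ (k - 1) = q" "Suc j div m ^ k = r"
    unfolding pow(1) div_mult2_eq using q assms(1) by (simp_all add: r_def)
  ultimately have cnt: "num_moves m k j = q - 1 - r"
    by (simp add: num_moves_def)
  have "r \<le> m * r"
    using assms(1) by simp
  then have "r + 1 \<le> q"
    using s qrs by linarith
  then have int_cnt: "int (num_moves m k j) = int q - 1 - int r"
    unfolding cnt by linarith
  have jm: "Suc j div m = m ^ e * q"
    using q pow assms(1) by simp
  have coprime: "coprime (int (m + 1)) (int (m ^ e))"
    by (simp del: of_nat_Suc of_nat_power of_nat_add add: coprime_Suc_left_nat)
  \<comment> \<open>\<open>u\<close> is 0 for the count before the move and 1 for the count after
    it, so both claims are instances.\<close>
  have key: "\<not> [m ^ (k - 1) * t = (m - 1) * (m ^ e * q)] (mod (m + 1))"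
    if u: "int t = int q - 1 - int r + int u" "u = 0 \<or> u = 1" for t u
  proof
    assume "[m ^ (k - 1) * t = (m - 1) * (m ^ e * q)] (mod (m + 1))"
    then have "[int (m * m ^ e * t) = int ((m - 1) * (m ^ e * q))] (mod int (m + 1))"
      by (simp only: cong_int_iff pow(2))
    then have "int (m + 1) dvd int m ^ e * (int m * int t - (int m - 1) * int q)"
      using assms(1) by (simp add: cong_iff_dvd_diff of_nat_diff algebra_simps)
    then have "int (m + 1) dvd int m * int t - (int m - 1) * int q"
      using coprime by (simp add: coprime_dvd_mult_right_iff)
    also have "int m * int t - (int m - 1) * int q =
        (int s + 1 - int u) + int (m + 1) * (int u - 1)"
      unfolding u(1) qrs by (simp add: algebra_simps)
    finally have "int (m + 1) dvd int s + 1 - int u"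
      by (simp only: dvd_add_left_iff dvd_triv_left)
    then have "int (m + 1) \<le> int s + 1 - int u"
      using s u(2) by (intro zdvd_imp_le) auto
    then show False
      using s by auto
  qed
  show "peg m k (num_moves m k j) \<noteq> (m - 1) * (Suc j div m) mod (m + 1)"
    using key[of "num_moves m k j" 0] int_cnt by (simp add: peg_def jm cong_def)
  show "peg m k (Suc (num_moves m k j)) \<noteq> (m - 1) * (Suc j div m) mod (m + 1)"
    using key[of "Suc (num_moves m k j)" 1] int_cnt by (simp add: peg_def jm cong_def)
qed

lemma move_state_iff:
  assumes "m \<ge> 1" "1 \<le> k" "k \<le> n" "m ^ (k - 1) dvd Suc j" "\<not> m ^ k dvd Suc j"
  shows "move m k (state m n j) c \<longleftrightarrow> c = state m n (Suc j)"
  unfolding state_def num_moves_Suc[OF assms(1,2,4,5)]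
proof (rule move_sorted_config_iff[OF assms(2,3)])
  fix i
  assume i: "1 \<le> i" "i < k"
  then have "m ^ i dvd Suc j"
    using assms(4) by (metis dvd_trans le_imp_power_dvd Suc_diff_1 less_Suc_eq_le
        assms(2) less_eq_Suc_le One_nat_def)
  then show "peg m i (num_moves m i j) \<noteq> peg m k (num_moves m k j) \<and>
      peg m i (num_moves m i j) \<noteq> peg m k (Suc (num_moves m k j))"
    using peg_lower[OF assms(1) i(1)] peg_mover[OF assms(1) _ assms(4,5)] i by auto
qed

lemma initial_eq_state: "initial n = state m n 0"
  by (auto simp: initial_def state_def sorted_config_def num_moves_def peg_def fun_eq_iff
      filter_empty_conv)

lemma digits_state: "digits m n (state m n j) = code m n j"
  by (simp add: digits_def state_def sorted_config_def code_def)

subsection \<open>The loop\<close>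

text \<open>A move whose number is not divisible by m is made by disk 1. The induction varies
  \<open>j\<close> because \<open>move_D1\<close> unfolds at its first move.\<close>

lemma move_D1_state_iff:
  assumes "m \<ge> 1" "n \<ge> 1" "\<And>i. i < k \<Longrightarrow> \<not> m dvd Suc (j + i)"
  shows "move_D1 m n k (state m n j) tr c \<longleftrightarrow>
    tr = map (code m n) [j + 1..<j + k + 1] \<and> c = state m n (j + k)"
  using assms(3)
proof (induction k arbitrary: j tr)
  case 0
  then show ?case
    by (auto elim: move_D1.cases intro: move_D1.intros)
next
  case (Suc k)
  have first: "move m 1 (state m n j) c' \<longleftrightarrow> c' = state m n (Suc j)" for c'
    using move_state_iff[of m 1 n j] assms(1,2) Suc.prems[of 0] by simp
  have rest: "move_D1 m n k (state m n (Suc j)) tr' c \<longleftrightarrow>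
      tr' = map (code m n) [Suc j + 1..<Suc j + k + 1] \<and> c = state m n (Suc j + k)" for tr'
    using Suc.prems by (intro Suc.IH) force
  have upt: "[j + 1..<j + Suc k + 1] = (j + 1) # [Suc j + 1..<Suc j + k + 1]"
    by (simp add: upt_conv_Cons del: upt_Suc)
  have "move_D1 m n (Suc k) (state m n j) tr c \<longleftrightarrow>
      (\<exists>c' tr'. tr = digits m n c' # tr' \<and> move m 1 (state m n j) c' \<and> move_D1 m n k c' tr' c)"
    by (subst move_D1.simps) auto
  also have "\<dots> \<longleftrightarrow> tr = map (code m n) [j + 1..<j + Suc k + 1] \<and> c = state m n (j + Suc k)"
    unfolding first upt using rest by (auto simp: digits_state simp del: upt_Suc)
  finally show ?case .
qed

lemma other_tops_sorted_config:
  "other_tops m (sorted_config m n f) =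
    {hd (filter (\<lambda>d. peg m d (f d) = p) [1..<n + 1]) | p.
      p \<le> m \<and> 1 \<notin> set (filter (\<lambda>d. peg m d (f d) = p) [1..<n + 1]) \<and>
      filter (\<lambda>d. peg m d (f d) = p) [1..<n + 1] \<noteq> []}"
  by (simp add: other_tops_def sorted_config_def)

lemma other_topsE:
  assumes "d \<in> other_tops m (sorted_config m n f)"
  obtains "1 \<le> d" "d \<le> n" "peg m d (f d) \<noteq> peg m 1 (f 1)"
proof -
  from assms obtain p where p: "d = hd (filter (\<lambda>d. peg m d (f d) = p) [1..<n + 1])"
    "1 \<notin> set (filter (\<lambda>d. peg m d (f d) = p) [1..<n + 1])"
    "filter (\<lambda>d. peg m d (f d) = p) [1..<n + 1] \<noteq> []"
    unfolding other_tops_sorted_config by blast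
  then have "d \<in> set (filter (\<lambda>d. peg m d (f d) = p) [1..<n + 1])"
    using hd_in_set by blast
  with p(2) that show ?thesis
    by auto
qed

text \<open>Every m^d with d \<le> n divides j + 1 = m^n, so \<open>peg_lower\<close> puts all disks
  on the peg of disk 1.\<close>

lemma other_tops_state_empty:
  assumes "m \<ge> 1" "Suc j = m ^ n"
  shows "other_tops m (state m n j) = {}"
proof -
  have "False" if "d \<in> other_tops m (state m n j)" for d
    using that unfolding state_def
  proof (rule other_topsE)
    assume d: "1 \<le> d" "d \<le> n" "peg m d (num_moves m d j) \<noteq> peg m 1 (num_moves m 1 j)"
    have "m ^ d dvd Suc j" "m ^ 1 dvd Suc j"
      unfolding assms(2) using d by (intro le_imp_power_dvd; simp)+
    then show False
      using d peg_lower[OF assms(1) d(1), of j] peg_lower[OF assms(1), of 1 j] by simp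
  qed
  then show ?thesis
    by blast
qed

text \<open>The disks below k share the peg of disk 1 and disk k is elsewhere. So k is on top of its
  stack and a candidate, and no smaller disk is one.\<close>

lemma other_tops_state:
  assumes "m \<ge> 1" "2 \<le> k" "k \<le> n" "m ^ (k - 1) dvd Suc j" "\<not> m ^ k dvd Suc j"
  shows "other_tops m (state m n j) \<noteq> {}" "Min (other_tops m (state m n j)) = k"
proof -
  let ?T = "other_tops m (state m n j)"
  let ?l = "filter (\<lambda>d. peg m d (num_moves m d j) = peg m k (num_moves m k j)) [1..<n + 1]"
  have lower: "peg m i (num_moves m i j) = (m - 1) * (Suc j div m) mod (m + 1)"
    if "1 \<le> i" "i < k" for i
  proof (rule peg_lower[OF assms(1) that(1)])
    have "i \<le> k - 1"
      using that by simp
    then show "m ^ i dvd Suc j"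
      using assms(4) by (metis dvd_trans le_imp_power_dvd)
  qed
  have mover: "peg m k (num_moves m k j) \<noteq> (m - 1) * (Suc j div m) mod (m + 1)"
    by (rule peg_mover[OF assms(1,2,4,5)])
  have k: "1 \<le> k" "k \<le> n"
    using assms by auto
  have "filter (\<lambda>d. peg m d (num_moves m d j) = peg m k (num_moves m k j)) [1..<k] = []"
    using lower mover by (auto simp: filter_empty_conv)
  then have l: "hd ?l = k" "?l \<noteq> []"
    unfolding filter_upt_split[OF k] by simp_all
  have "1 \<notin> set ?l"
    using lower[of 1] mover assms(2) by auto
  moreover have "peg m k (num_moves m k j) \<le> m"
    unfolding peg_def by (metis Suc_eq_plus1 less_Suc_eq_le mod_less_divisor zero_less_Suc)
  ultimately have k_in: "k \<in> ?T"
    unfolding state_def other_tops_sorted_config mem_Collect_eq using l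
    by (intro exI[of _ "peg m k (num_moves m k j)"]) simp
  have ge: "k \<le> d" "d \<le> n" if "d \<in> ?T" for d
  proof -
    from that have "1 \<le> d \<and> d \<le> n \<and> peg m d (num_moves m d j) \<noteq> peg m 1 (num_moves m 1 j)"
      unfolding state_def by (rule other_topsE) simp
    then show "k \<le> d" "d \<le> n"
      using lower[of d] lower[of 1] assms(2) by (auto simp: not_le[symmetric])
  qed
  have "finite ?T"
    by (rule finite_subset[of _ "{..n}"]) (use ge in auto)
  then show "Min ?T = k"
    using k_in ge by (intro Min_eqI) auto
  show "?T \<noteq> {}"
    using k_in by blast
qed

text \<open>Here k - 1 is the exact exponent of m in N: at least 1 as m divides N, and less than n
  as m^n exceeds N > 0.\<close>

lemma ex_max_power_dvd:
  fixes m :: nat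
  assumes "m \<ge> 2" "m dvd N" "0 < N" "N < m ^ n"
  obtains k where "2 \<le> k" "k \<le> n" "m ^ (k - 1) dvd N" "\<not> m ^ k dvd N"
proof -
  define k where "k = (LEAST e. \<not> m ^ e dvd N)"
  have "\<not> m ^ n dvd N"
    using assms(3,4) by (auto dest: dvd_imp_le)
  then have k: "\<not> m ^ k dvd N" "k \<le> n"
    unfolding k_def by (rule LeastI, rule Least_le)
  have less: "m ^ e dvd N" if "e < k" for e
    using that not_less_Least unfolding k_def by blast
  have "k \<noteq> 0" "k \<noteq> 1"
    using k(1) assms(2) by (auto intro: Nat.gr0I)
  then have "2 \<le> k"
    by linarith
  then show ?thesis
    using k less[of "k - 1"] by (intro that[of k]) auto
qed

text \<open>Each round consists of m - 1 moves of disk 1 and, except in the last round, one move of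
  another disk, so rounds begin after a multiple of m moves. The induction is on the number of
  remaining rounds. The equivalence yields both that a terminating run exists and that its record is
  unique.\<close>

lemma EVEN_loop_state_iff:
  assumes m: "m \<ge> 2" and n: "n \<ge> 1" and "q < m ^ (n - 1)"
  shows "EVEN_loop m n (state m n (m * q)) tr \<longleftrightarrow> tr = map (code m n) [m * q + 1..<m ^ n]"
  using assms(3)
proof (induction "m ^ (n - 1) - q" arbitrary: q tr rule: less_induct)
  case less
  define j where "j = m * q + (m - 1)"
  have Suc_j: "Suc j = m * Suc q"
    using m by (simp add: j_def)
  have pow: "m ^ n = m * m ^ (n - 1)"
    using n by (cases n) auto
  have "\<not> m dvd Suc (m * q + i)" if "i < m - 1" for i
    using that by (metis add_Suc_right dvd_add_right_iff dvd_triv_left less_diff_conv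
        nat_dvd_not_less Suc_eq_plus1 zero_less_Suc)
  then have D1: "move_D1 m n (m - 1) (state m n (m * q)) tr' c \<longleftrightarrow>
      tr' = map (code m n) [m * q + 1..<j + 1] \<and> c = state m n j" for tr' c
    using move_D1_state_iff[of m n "m - 1" "m * q" tr' c] m n by (simp add: j_def)
  \<comment> \<open>The disjuncts are the rules \<open>stop\<close> and \<open>continue\<close>;
    \<open>D1\<close> fixes the configuration \<open>c\<close> in both, and its candidate set
    decides between them.\<close>
  have step: "EVEN_loop m n (state m n (m * q)) tr \<longleftrightarrow>
      (\<exists>c. move_D1 m n (m - 1) (state m n (m * q)) tr c \<and> other_tops m c = {}) \<or>
      (\<exists>tr1 c c' tr2. tr = tr1 @ digits m n c' # tr2 \<and>
        move_D1 m n (m - 1) (state m n (m * q)) tr1 c \<and> other_tops m c \<noteq> {} \<and>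
        move m (Min (other_tops m c)) c c' \<and> EVEN_loop m n c' tr2)"
    by (subst EVEN_loop.simps) blast
  show ?case
  proof (cases "Suc q = m ^ (n - 1)")
    case True
    then have end_j: "Suc j = m ^ n"
      by (simp only: Suc_j pow)
    have "other_tops m (state m n j) = {}"
      using m end_j by (intro other_tops_state_empty) auto
    then have "EVEN_loop m n (state m n (m * q)) tr \<longleftrightarrow>
        tr = map (code m n) [m * q + 1..<j + 1]"
      unfolding step D1 by blast
    with end_j show ?thesis
      by simp
  next
    case False
    then have q: "Suc q < m ^ (n - 1)"
      using less.prems by simp
    have lt: "m * Suc q < m ^ n"
      unfolding pow using q m by (intro mult_strict_left_mono) auto
    have "m dvd Suc j" "0 < Suc j" "Suc j < m ^ n"
      using lt by (simp_all only: Suc_j dvd_triv_left) (use m in simp)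
    then obtain k where k: "2 \<le> k" "k \<le> n" "m ^ (k - 1) dvd Suc j" "\<not> m ^ k dvd Suc j"
      by (rule ex_max_power_dvd[OF m])
    have m1: "m \<ge> 1" and k1: "1 \<le> k"
      using m k by auto
    note tops = other_tops_state[OF m1 k]
    have IH: "EVEN_loop m n (state m n (Suc j)) tr' \<longleftrightarrow>
        tr' = map (code m n) [Suc j + 1..<m ^ n]" for tr'
      unfolding Suc_j using q by (intro less.hyps) auto
    have "EVEN_loop m n (state m n (m * q)) tr \<longleftrightarrow>
        tr = map (code m n) [m * q + 1..<j + 1] @ digits m n (state m n (Suc j)) #
          map (code m n) [Suc j + 1..<m ^ n]"
      unfolding step D1 by (simp add: tops move_state_iff[OF m1 k1 k(2-4)] IH del: upt_Suc)
    also have "map (code m n) [m * q + 1..<j + 1] @ digits m n (state m n (Suc j)) #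
          map (code m n) [Suc j + 1..<m ^ n] =
        map (code m n) ([m * q + 1..<j + 1] @ [j + 1..<m ^ n])"
      using \<open>Suc j < m ^ n\<close> by (simp add: digits_state upt_conv_Cons[of "Suc j"] del: upt_Suc)
    also have "[m * q + 1..<j + 1] @ [j + 1..<m ^ n] = [m * q + 1..<m ^ n]"
      using lt Suc_j upt_add_eq_append[of "m * q + 1" "j + 1" "m ^ n - (j + 1)"]
      by (simp add: j_def)
    finally show ?thesis .
  qed
qed

subsection \<open>The Gray code\<close>

text \<open>The period has length 2 (m - 1): m - 1 steps up, then m - 1 steps down. Hence the count
  (m - 1) q + s is place s of sweep q, which goes up for even q. The place s = m - 1 is also the
  start of the next sweep.\<close>

lemma digit_reflected:
  assumes m: "m \<ge> 2" and s: "s < m"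
  shows "digit m ((m - 1) * q + s) = (if even q then s else m - 1 - s)"
proof -
  have len: "length (digit_period m) = 2 * (m - 1)"
    using m by (simp add: digit_period_def)
  show ?thesis
  proof (cases "even q")
    case True
    then obtain u where "q = 2 * u" ..
    then have "((m - 1) * q + s) mod (2 * (m - 1)) = (s + 2 * (m - 1) * u) mod (2 * (m - 1))"
      by (simp add: algebra_simps)
    also have "\<dots> = s"
      using m s by simp
    finally have idx: "((m - 1) * q + s) mod (2 * (m - 1)) = s" .
    show ?thesis
      unfolding digit_def len idx using True s by (simp add: digit_period_def nth_append)
  next
    case False
    then obtain u where "q = 2 * u + 1" ..
    then have mod: "((m - 1) * q + s) mod (2 * (m - 1)) =
        (m - 1 + s + 2 * (m - 1) * u) mod (2 * (m - 1))"
      by (simp add: algebra_simps)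
    show ?thesis
    proof (cases "s = m - 1")
      case True
      \<comment> \<open>At the end of a downward sweep the index wraps around to 0, where the entry
        is 0 = m - 1 - s.\<close>
      then have "(m - 1 + s + 2 * (m - 1) * u) mod (2 * (m - 1)) = 0"
        by (simp flip: mult_2)
      then show ?thesis
        using False True m unfolding digit_def len mod
        by (simp add: digit_period_def nth_append)
    next
      case neq: False
      then have "m - 1 + s < 2 * (m - 1)"
        using s by linarith
      then have "(m - 1 + s + 2 * (m - 1) * u) mod (2 * (m - 1)) = m - 1 + s"
        by (simp only: mod_mult_self2 mod_less)
      then show ?thesis
        using False neq m s unfolding digit_def len mod
        by (auto simp: digit_period_def nth_append rev_nth)
    qed
  qed
qed

text \<open>Dropping the last base-m digit of the move number lowers all exponents by one. This
  makes the digits other than the last those of the code at index q.\<close>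

lemma num_moves_div:
  assumes "s < m" "d \<ge> 1"
  shows "num_moves m (Suc d) (m * q + s) = num_moves m d q"
proof -
  have "(m * q + s) div m ^ Suc e = q div m ^ e" for e
    using assms(1) by (simp add: div_mult2_eq)
  from this[of d] this[of "d - 1"] show ?thesis
    using assms(2) by (simp add: num_moves_def)
qed

text \<open>Disk 1 has moved m q + s - q = (m - 1) q + s times, so its digit is at place s of sweep
  q. This is the recursion of \<open>gray\<close> in closed form.\<close>

lemma code_Suc:
  assumes "m \<ge> 2" "s < m"
  shows "code m (Suc n) (m * q + s) = code m n q @ [if even q then s else m - 1 - s]"
proof -
  have "rev [1..<Suc n + 1] = map Suc (rev [1..<n + 1]) @ [1]"
    by (simp add: map_Suc_upt rev_map[symmetric] upt_conv_Cons del: upt_Suc)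
  moreover have "digit m (num_moves m 1 (m * q + s)) = (if even q then s else m - 1 - s)"
  proof -
    have "num_moves m 1 (m * q + s) = (m - 1) * q + s"
      using assms by (simp add: num_moves_def algebra_simps)
    then show ?thesis
      by (simp only: digit_reflected[OF assms])
  qed
  moreover have "map (\<lambda>d. digit m (num_moves m d (m * q + s))) (map Suc (rev [1..<n + 1])) = code m n q"
    unfolding code_def map_map using assms by (intro map_cong) (auto simp: num_moves_div)
  ultimately show ?thesis
    by (simp add: code_def del: upt_Suc)
qed

lemma map_upt_mult:
  "map f [0..<N * m] = concat (map (\<lambda>q. map (\<lambda>s. f (m * q + s)) [0..<m]) [0..<N])"
proof (induction N)
  case (Suc N)
  have "[0..<Suc N * m] = [0..<N * m] @ [N * m..<N * m + m]"
    using upt_add_eq_append[of 0 "N * m" m] by (simp add: add.commute)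
  also have "[N * m..<N * m + m] = map (\<lambda>s. m * N + s) [0..<m]"
    using map_add_upt[of "N * m" m] by (simp add: add.commute mult.commute)
  finally show ?case
    using Suc.IH by simp
qed simp

lemma gray_eq:
  assumes m: "m \<ge> 2"
  shows "gray m n = map (code m n) [0..<m ^ n]"
proof (induction n)
  case 0
  then show ?case
    by (simp add: code_def)
next
  case (Suc n)
  have rev: "rev [0..<m] = map (\<lambda>s. m - 1 - s) [0..<m]"
    by (rule nth_equalityI) (auto simp: rev_nth)
  \<comment> \<open>The index i in \<open>gray\<close> starts at 1, so odd i becomes even q = i -
    1.\<close>
  have "gray m (Suc n) = concat (map (\<lambda>q. map (\<lambda>x. map (code m n) [0..<m ^ n] ! q @ [x])
      (if even q then [0..<m] else rev [0..<m])) [0..<m ^ n])"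
    by (simp add: Suc.IH map_Suc_upt[symmetric] o_def del: upt_Suc)
  also have "\<dots> = concat (map (\<lambda>q. map (\<lambda>x. code m n q @ [x])
      (if even q then [0..<m] else rev [0..<m])) [0..<m ^ n])"
    by (intro arg_cong[where f = concat] map_cong) auto
  also have "\<dots> = concat (map (\<lambda>q. map (\<lambda>s. code m (Suc n) (m * q + s)) [0..<m]) [0..<m ^ n])"
  proof (rule arg_cong[where f = concat], rule map_cong[OF refl])
    fix q
    show "map (\<lambda>x. code m n q @ [x]) (if even q then [0..<m] else rev [0..<m]) =
        map (\<lambda>s. code m (Suc n) (m * q + s)) [0..<m]"
      using m by (cases "even q") (simp_all add: code_Suc rev)
  qed
  also have "\<dots> = map (code m (Suc n)) [0..<m ^ Suc n]"
    by (simp only: map_upt_mult[symmetric] power_Suc2)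
  finally show ?case .
qed

theorem theorem2:
  fixes m n :: nat and tr :: "nat list list"
  assumes "m \<ge> 2" and "even m" and "n \<ge> 1"
  shows "EVEN_run m n tr \<longleftrightarrow> tr = gray m n"
proof -
  have "EVEN_loop m n (initial n) tr' \<longleftrightarrow> tr' = map (code m n) [1..<m ^ n]" for tr'
    using EVEN_loop_state_iff[of m n 0 tr'] assms by (simp add: initial_eq_state[of n m])
  \<comment> \<open>Index 0 is the tuple recorded after initialization, outside the loop.\<close>
  moreover have "gray m n = code m n 0 # map (code m n) [1..<m ^ n]"
    using assms by (simp add: gray_eq upt_conv_Cons)
  ultimately show ?thesis
    by (auto simp: EVEN_run_def initial_eq_state[of n m] digits_state)
qed

end
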